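(* Let $l\le k$ be nonnegative integers and let $\tau\in B_l$. Let $P=\tau(l+1)(l+2)\ldots k\in B_k$ and $Q=\bar{\tau}(l+1)(l+2)\ldots k\in B_k$. Then $P$ and $Q$ are Wilf equivalent, i.e. $|B_n(P)|=|B_n(Q)|$ for all $n\ge 1$. Moreover, $|SI_n(P)|=|SI_n(Q)|$ for all $n\ge1$.
   Context: $B_n$ is the set of signed permutations of $[n]=\{1,\dots,n\}$, written as words $\pi=\pi_1\cdots\pi_n$ in which each of $1,\dots,n$ appears exactly once, possibly barred (barred = negative, unbarred = positive). $|\pi_i|$ denotes the underlying unsigned value. For $\pi\in B_n$, $\bar{\pi}$ is obtained by changing the sign of every entry. A signed permutation $\pi\in B_n$ contains $\tau\in B_k$ if there are indices $i_1<\dots<i_k$ such that for all $a,b\in[k]$: $|\pi_{i_a}|<|\pi_{i_b}|$ iff $|\tau_a|<|\tau_b|$, and $\pi_{i_a}$ is positive iff $\tau_a$ is positive; otherwise $\pi$ avoids $\tau$. $M(\tau)$ denotes the set of elements of $M$ avoiding $\tau$. $SI_n\subseteq B_n$ is the set of signed involutions, i.e. signed permutations $\pi$ which, viewed as bijections of $\{\pm1,\dots,\pm n\}$ with $\pi(-i)=-\pi(i)$, satisfy $\pi\circ\pi=\mathrm{id}$. The word $\tau(l+1)(l+2)\ldots k$ denotes the concatenation of the word $\tau$ (on values $1,\dots,l$) with the unbarred letters $l+1,\dots,k$. *)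

theory Defs
  imports Main
begin

text \<open>A signed permutation is its word, as a list of integers; a barred letter is a negative
  integer. List positions count from 0, so \<open>\<pi>\<^sub>i\<close> is \<open>\<pi> ! (i - 1)\<close>.\<close>

definition signed_perms :: "nat \<Rightarrow> int list set" where
  "signed_perms n =
     {\<pi>. length \<pi> = n \<and> distinct (map abs \<pi>) \<and> set (map abs \<pi>) = {1..int n}}"

definition bar :: "int list \<Rightarrow> int list" where
  "bar \<pi> = map uminus \<pi>"

definition sp_contains :: "int list \<Rightarrow> int list \<Rightarrow> bool" where
  "sp_contains \<pi> \<tau> \<longleftrightarrow>
     (\<exists>f :: nat \<Rightarrow> nat.
        strict_mono_on {..<length \<tau>} f \<and> f ` {..<length \<tau>} \<subseteq> {..<length \<pi>} \<and>
        (\<forall>a < length \<tau>. \<forall>b < length \<tau>.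
           (\<bar>\<pi> ! f a\<bar> < \<bar>\<pi> ! f b\<bar> \<longleftrightarrow> \<bar>\<tau> ! a\<bar> < \<bar>\<tau> ! b\<bar>)) \<and>
        (\<forall>a < length \<tau>. \<pi> ! f a > 0 \<longleftrightarrow> \<tau> ! a > 0))"

definition avoiders :: "int list set \<Rightarrow> int list \<Rightarrow> int list set" where
  "avoiders M \<tau> = {\<pi> \<in> M. \<not> sp_contains \<pi> \<tau>}"

text \<open>The odd extension of a word to \<open>{\<plusminus>1, \<dots>, \<plusminus>n}\<close>; the value at 0 is irrelevant.\<close>

definition sp_fun :: "int list \<Rightarrow> int \<Rightarrow> int" where
  "sp_fun \<pi> i = (if i > 0 then \<pi> ! (nat i - 1) else - (\<pi> ! (nat (- i) - 1)))"

definition signed_involutions :: "nat \<Rightarrow> int list set" where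
  "signed_involutions n =
     {\<pi> \<in> signed_perms n. \<forall>i \<in> {- int n..int n} - {0}. sp_fun \<pi> (sp_fun \<pi> i) = i}"

definition wilf_equivalent :: "int list \<Rightarrow> int list \<Rightarrow> bool" where
  "wilf_equivalent P Q \<longleftrightarrow>
     (\<forall>n\<ge>1. card (avoiders (signed_perms n) P) = card (avoiders (signed_perms n) Q))"

lemma finite_signed_perms: "finite (signed_perms n)"
proof (rule finite_subset)
  show "signed_perms n \<subseteq> {\<pi>. set \<pi> \<subseteq> {- int n..int n} \<and> length \<pi> = n}"
    by (force simp: signed_perms_def)
  show "finite {\<pi>. set \<pi> \<subseteq> {- int n..int n} \<and> length \<pi> = n}"
    by (rule finite_lists_length_eq) simp
qed

lemma bar_signed_perms: "\<tau> \<in> signed_perms l \<Longrightarrow> bar \<tau> \<in> signed_perms l"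
  by (simp add: signed_perms_def bar_def comp_def image_image)

lemma append_signed_perms:
  assumes "l \<le> k" and "\<tau> \<in> signed_perms l"
  shows "\<tau> @ [int l + 1..int k] \<in> signed_perms k"
proof -
  have "map abs [int l + 1..int k] = [int l + 1..int k]"
    by (rule map_idI) auto
  moreover have "{1..int l} \<union> {int l + 1..int k} = {1..int k}"
    using assms(1) by auto
  ultimately show ?thesis
    using assms by (auto simp: signed_perms_def simp del: set_map)
qed

end

theory Submission
  imports Defs
begin

text \<open>Put \<open>m = k - l\<close> and call a cell \<open>(i, v)\<close> covered if strictly north-east of it the word has an
  increasing sequence of \<open>m\<close> positive letters. The covered cells are closed under moving
  south-west, and a copy of \<open>P\<close> is a copy of \<open>\<tau>\<close> whose bounding corner is covered, so that all its
  letters lie in covered cells. Hence changing the sign of every letter in a covered cell turns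
  copies of \<open>P\<close> into copies of \<open>Q\<close>, provided that the covered region itself does not change. It does
  not, since every covered cell has a witnessing sequence consisting of uncovered letters only.
  Sign changing is therefore an involution on \<open>B\<^sub>n\<close> exchanging the avoiders of \<open>P\<close> and \<open>Q\<close>. For a
  signed involution the covered region is symmetric about the diagonal, so the image is again a
  signed involution.\<close>

section \<open>Covered cells and the sign-changing map\<close>

definition increasing_above :: "int list \<Rightarrow> nat \<Rightarrow> int \<Rightarrow> nat set \<Rightarrow> bool" where
  "increasing_above \<pi> i v C \<longleftrightarrow>
     C \<subseteq> {i<..<length \<pi>} \<and> (\<forall>j\<in>C. v < \<pi> ! j) \<and> strict_mono_on C ((!) \<pi>)"

text \<open>Positivity of the witnessing letters is encoded by \<open>v < \<pi> ! j\<close> and is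
  guaranteed once \<open>v \<ge> 0\<close>. For \<open>m = 0\<close> the empty set is a witness, so
  every cell is covered and \<open>flip_covered\<close> is \<open>bar\<close>.\<close>

definition covered :: "nat \<Rightarrow> int list \<Rightarrow> nat \<Rightarrow> int \<Rightarrow> bool" where
  "covered m \<pi> i v \<longleftrightarrow> (\<exists>C. increasing_above \<pi> i v C \<and> card C = m)"

definition flip_covered :: "nat \<Rightarrow> int list \<Rightarrow> int list" where
  "flip_covered m \<pi> =
     map (\<lambda>i. if covered m \<pi> i \<bar>\<pi> ! i\<bar> then - (\<pi> ! i) else \<pi> ! i) [0..<length \<pi>]"

lemma increasing_above_antimono:
  assumes "increasing_above \<pi> i v C" "i' \<le> i" "v' \<le> v"
  shows "increasing_above \<pi> i' v' C"
  using assms unfolding increasing_above_def by fastforce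

lemma covered_antimono:
  assumes "covered m \<pi> i v" "i' \<le> i" "v' \<le> v"
  shows "covered m \<pi> i' v'"
  using assms increasing_above_antimono unfolding covered_def by blast

lemma length_flip_covered [simp]: "length (flip_covered m \<pi>) = length \<pi>"
  by (simp add: flip_covered_def)

lemma nth_flip_covered:
  "i < length \<pi> \<Longrightarrow>
     flip_covered m \<pi> ! i = (if covered m \<pi> i \<bar>\<pi> ! i\<bar> then - (\<pi> ! i) else \<pi> ! i)"
  by (simp add: flip_covered_def)

lemma abs_nth_flip_covered [simp]:
  "i < length \<pi> \<Longrightarrow> \<bar>flip_covered m \<pi> ! i\<bar> = \<bar>\<pi> ! i\<bar>"
  by (simp add: nth_flip_covered)

text \<open>If a witness contains a position \<open>p\<close> whose own cell is covered, a witness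
  for that cell also serves \<open>(i, v)\<close>, since \<open>i < p\<close> and
  \<open>v < \<pi> ! p\<close>. Passing to \<open>p\<close> moves strictly to the right, so the
  replacement terminates.\<close>

lemma covered_by_uncovered:
  assumes "covered m \<pi> i v"
  shows "\<exists>C. increasing_above \<pi> i v C \<and> card C = m \<and> (\<forall>p\<in>C. \<not> covered m \<pi> p \<bar>\<pi> ! p\<bar>)"
  using assms
proof (induction "length \<pi> - i" arbitrary: i v rule: less_induct)
  case less
  obtain C where C: "increasing_above \<pi> i v C" "card C = m"
    using less.prems unfolding covered_def by blast
  show ?case
  proof (cases "\<exists>p\<in>C. covered m \<pi> p \<bar>\<pi> ! p\<bar>")
    case True
    then obtain p where p: "p \<in> C" "covered m \<pi> p \<bar>\<pi> ! p\<bar>"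
      by blast
    have "i < p" "p < length \<pi>" "v < \<pi> ! p"
      using C(1) p(1) unfolding increasing_above_def by auto
    then obtain D where "increasing_above \<pi> p \<bar>\<pi> ! p\<bar> D" "card D = m"
      "\<forall>q\<in>D. \<not> covered m \<pi> q \<bar>\<pi> ! q\<bar>"
      using less.hyps[OF diff_less_mono2 p(2)] by (metis less_trans)
    moreover have "i \<le> p" "v \<le> \<bar>\<pi> ! p\<bar>"
      using \<open>i < p\<close> \<open>v < \<pi> ! p\<close> by linarith+
    ultimately show ?thesis
      using increasing_above_antimono by blast
  qed (use C in blast)
qed

lemma increasing_above_cong:
  assumes "length \<pi>' = length \<pi>" "\<And>p. p \<in> C \<Longrightarrow> \<pi>' ! p = \<pi> ! p"
  shows "increasing_above \<pi>' i v C \<longleftrightarrow> increasing_above \<pi> i v C"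
  using assms unfolding increasing_above_def strict_mono_on_def by auto

text \<open>A witness made of uncovered letters survives the sign change. Conversely, a witness in
  the changed word either consists of unchanged letters or contains a covered position, and then
  \<open>(i, v)\<close> lies south-west of a covered cell of \<open>\<pi>\<close>.\<close>

lemma covered_flip_covered [simp]: "covered m (flip_covered m \<pi>) i v \<longleftrightarrow> covered m \<pi> i v"
proof
  assume "covered m (flip_covered m \<pi>) i v"
  then obtain C where C: "increasing_above (flip_covered m \<pi>) i v C" "card C = m"
    unfolding covered_def by blast
  have C_less: "p < length \<pi>" "i < p" "v < flip_covered m \<pi> ! p" if "p \<in> C" for p
    using C(1) that unfolding increasing_above_def by auto
  show "covered m \<pi> i v"
  proof (cases "\<exists>p\<in>C. covered m \<pi> p \<bar>\<pi> ! p\<bar>")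
    case True
    then obtain p where p: "p \<in> C" "covered m \<pi> p \<bar>\<pi> ! p\<bar>"
      by blast
    \<comment> \<open>The changed letter exceeds \<open>v\<close> and has the same absolute value as
      \<open>\<pi> ! p\<close>.\<close>
    have "v \<le> \<bar>\<pi> ! p\<bar>"
      using C_less[OF p(1)] abs_nth_flip_covered[of p \<pi> m] by linarith
    then show ?thesis
      using covered_antimono[OF p(2)] C_less[OF p(1)] by simp
  next
    case False
    then have "flip_covered m \<pi> ! p = \<pi> ! p" if "p \<in> C" for p
      using that C_less(1)[OF that] by (simp add: nth_flip_covered)
    then show ?thesis
      using C increasing_above_cong[of "flip_covered m \<pi>" \<pi> C i v] unfolding covered_def by auto
  qed
next
  assume "covered m \<pi> i v"
  then obtain C where C: "increasing_above \<pi> i v C" "card C = m"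
    "\<forall>p\<in>C. \<not> covered m \<pi> p \<bar>\<pi> ! p\<bar>"
    using covered_by_uncovered by blast
  have "flip_covered m \<pi> ! p = \<pi> ! p" if "p \<in> C" for p
    using C that by (subst nth_flip_covered) (auto simp: increasing_above_def)
  then show "covered m (flip_covered m \<pi>) i v"
    using C increasing_above_cong[of "flip_covered m \<pi>" \<pi> C i v] unfolding covered_def by auto
qed

lemma flip_covered_flip_covered [simp]: "flip_covered m (flip_covered m \<pi>) = \<pi>"
  by (rule nth_equalityI) (simp_all add: nth_flip_covered)

lemma map_abs_flip_covered [simp]: "map abs (flip_covered m \<pi>) = map abs \<pi>"
  by (rule nth_equalityI) simp_all

lemma flip_covered_signed_perms:
  "\<pi> \<in> signed_perms n \<Longrightarrow> flip_covered m \<pi> \<in> signed_perms n"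
  unfolding signed_perms_def by (simp del: set_map)

lemma signed_perms_abs_nth:
  assumes "\<pi> \<in> signed_perms n" "i < n"
  shows "\<bar>\<pi> ! i\<bar> \<in> {1..int n}"
proof -
  have "\<bar>\<pi> ! i\<bar> \<in> set (map abs \<pi>)"
    using nth_mem[of i "map abs \<pi>"] assms by (simp add: signed_perms_def del: set_map)
  then show ?thesis
    using assms(1) unfolding signed_perms_def by blast
qed

subsection \<open>Pattern occurrences\<close>

text \<open>The index map is made explicit so that the same map can be reused for
  \<open>bar \<tau>\<close> after the sign change.\<close>

definition occurrence :: "int list \<Rightarrow> int list \<Rightarrow> (nat \<Rightarrow> nat) \<Rightarrow> bool" where
  "occurrence \<pi> \<tau> f \<longleftrightarrow>
     strict_mono_on {..<length \<tau>} f \<and> f ` {..<length \<tau>} \<subseteq> {..<length \<pi>} \<and>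
     (\<forall>a < length \<tau>. \<forall>b < length \<tau>.
        (\<bar>\<pi> ! f a\<bar> < \<bar>\<pi> ! f b\<bar> \<longleftrightarrow> \<bar>\<tau> ! a\<bar> < \<bar>\<tau> ! b\<bar>)) \<and>
     (\<forall>a < length \<tau>. \<pi> ! f a > 0 \<longleftrightarrow> \<tau> ! a > 0)"

lemma sp_contains_iff_occurrence: "sp_contains \<pi> \<tau> \<longleftrightarrow> (\<exists>f. occurrence \<pi> \<tau> f)"
  unfolding sp_contains_def occurrence_def ..

lemma nth_append_upto:
  assumes "length \<tau> = l" "a < k"
  shows "(\<tau> @ [int l + 1..int k]) ! a = (if a < l then \<tau> ! a else int a + 1)"
  using assms by (auto simp: nth_append)

text \<open>In a copy of the long pattern, the letters playing \<open>l + 1, ..., k\<close> are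
  positive, increasing, to the right of the copy of \<open>\<tau>\<close> and larger than all its
  absolute values. They witness that the north-east corner of its bounding box is covered.\<close>

lemma contains_append_upto_imp_covered:
  assumes "\<tau> \<in> signed_perms l" "0 < l" "l \<le> k"
    and "sp_contains \<pi> (\<tau> @ [int l + 1..int k])"
  shows "\<exists>g i v. occurrence \<pi> \<tau> g \<and> covered (k - l) \<pi> i v \<and>
           (\<forall>a<l. g a \<le> i \<and> \<bar>\<pi> ! g a\<bar> \<le> v)"
proof -
  define P where "P = \<tau> @ [int l + 1..int k]"
  have len: "length \<tau> = l" "length P = k"
    using assms(1,3) by (auto simp: signed_perms_def P_def)
  have P_nth: "P ! a = (if a < l then \<tau> ! a else int a + 1)" if "a < k" for a
    unfolding P_def using nth_append_upto[OF len(1) that] .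
  have \<tau>_le: "\<bar>\<tau> ! a\<bar> \<le> int l" if "a < l" for a
    using signed_perms_abs_nth[OF assms(1) that] by simp
  obtain f where f: "occurrence \<pi> P f"
    using assms(4) unfolding P_def sp_contains_iff_occurrence by blast
  have f_mono: "f a < f b" if "a < b" "b < k" for a b
    using f that len unfolding occurrence_def strict_mono_on_def by auto
  have f_less: "f a < length \<pi>" if "a < k" for a
    using f that len unfolding occurrence_def by auto
  have f_abs: "\<bar>\<pi> ! f a\<bar> < \<bar>\<pi> ! f b\<bar> \<longleftrightarrow> \<bar>P ! a\<bar> < \<bar>P ! b\<bar>" if "a < k" "b < k" for a b
    using f that len unfolding occurrence_def by auto
  have f_pos: "\<pi> ! f a > 0 \<longleftrightarrow> P ! a > 0" if "a < k" for a
    using f that len unfolding occurrence_def by auto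
  \<comment> \<open>The height of the corner; the maximum may be attained at a position other than
    \<open>f (l - 1)\<close>. The assumption \<open>0 < l\<close> makes the set nonempty.\<close>
  define v where "v = Max ((\<lambda>a. \<bar>\<pi> ! f a\<bar>) ` {..<l})"
  have occ: "occurrence \<pi> \<tau> f"
    unfolding occurrence_def len
    using f_mono f_less f_abs f_pos P_nth \<open>l \<le> k\<close> by (auto simp: strict_mono_on_def)
  have v_ge: "\<bar>\<pi> ! f a\<bar> \<le> v" if "a < l" for a
    unfolding v_def using that by auto
  have corner: "f a \<le> f (l - 1)" if "a < l" for a
  proof (cases "a < l - 1")
    case True
    then show ?thesis
      using f_mono[of a "l - 1"] \<open>l \<le> k\<close> by linarith
  next
    case False
    then have "a = l - 1"
      using that by linarith
    then show ?thesis
      by simp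
  qed
  have pos: "0 < \<pi> ! f a" if "l \<le> a" "a < k" for a
    using f_pos[OF that(2)] P_nth[OF that(2)] that by simp
  have v_less: "v < \<pi> ! f a" if a: "l \<le> a" "a < k" for a
  proof -
    have "v \<in> (\<lambda>a. \<bar>\<pi> ! f a\<bar>) ` {..<l}"
      unfolding v_def using \<open>0 < l\<close> by (intro Max_in) auto
    then obtain b where b: "b < l" "v = \<bar>\<pi> ! f b\<bar>"
      by auto
    have "\<bar>P ! b\<bar> < \<bar>P ! a\<bar>"
      using P_nth[of a] P_nth[of b] \<tau>_le[OF b(1)] a b(1) by simp
    then have "v < \<bar>\<pi> ! f a\<bar>"
      using f_abs[of b a] a b by simp
    then show ?thesis
      using pos[OF a] by simp
  qed
  have "increasing_above \<pi> (f (l - 1)) v (f ` {l..<k})"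
    unfolding increasing_above_def
  proof (intro conjI)
    show "f ` {l..<k} \<subseteq> {f (l - 1)<..<length \<pi>}"
      using f_mono[of "l - 1"] f_less \<open>0 < l\<close> by auto
    show "\<forall>j\<in>f ` {l..<k}. v < \<pi> ! j"
      using v_less by auto
    show "strict_mono_on (f ` {l..<k}) ((!) \<pi>)"
    proof (rule strict_mono_onI)
      fix x y assume "x \<in> f ` {l..<k}" "y \<in> f ` {l..<k}" "x < y"
      then obtain a b where ab: "x = f a" "y = f b" "l \<le> a" "a < k" "l \<le> b" "b < k" "f a < f b"
        by auto
      have "a < b"
        using f_mono[of b a] ab by (cases a b rule: linorder_cases) auto
      then have "\<bar>\<pi> ! f a\<bar> < \<bar>\<pi> ! f b\<bar>"
        using f_abs[of a b] P_nth ab by auto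
      then show "\<pi> ! x < \<pi> ! y"
        using pos[of a] pos[of b] ab by simp
    qed
  qed
  moreover have "inj_on f {l..<k}"
    by (rule inj_onI) (metis atLeastLessThan_iff f_mono less_irrefl linorder_neqE_nat)
  then have "card (f ` {l..<k}) = k - l"
    by (simp add: card_image)
  ultimately have "covered (k - l) \<pi> (f (l - 1)) v"
    unfolding covered_def by blast
  then show ?thesis
    using occ corner v_ge by blast
qed

text \<open>The copy of \<open>\<tau>\<close> is prolonged by the positions of a witness for the
  corner, taken in increasing order. The bound \<open>0 \<le> v\<close> makes the added letters
  positive, as the unbarred letters \<open>l + 1, ..., k\<close> demand.\<close>

lemma covered_imp_contains_append_upto:
  assumes "\<tau> \<in> signed_perms l" "l \<le> k"
    and g: "occurrence \<pi> \<tau> g" and "covered (k - l) \<pi> i v"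
    and corner: "\<And>a. a < l \<Longrightarrow> g a \<le> i \<and> \<bar>\<pi> ! g a\<bar> \<le> v" and "0 \<le> v"
  shows "sp_contains \<pi> (\<tau> @ [int l + 1..int k])"
proof -
  define P where "P = \<tau> @ [int l + 1..int k]"
  have len: "length \<tau> = l" "length P = k"
    using assms(1,2) by (auto simp: signed_perms_def P_def)
  have P_nth: "P ! a = (if a < l then \<tau> ! a else int a + 1)" if "a < k" for a
    unfolding P_def using nth_append_upto[OF len(1) that] .
  have \<tau>_le: "\<bar>\<tau> ! a\<bar> \<le> int l" if "a < l" for a
    using signed_perms_abs_nth[OF assms(1) that] by simp
  obtain C where C: "increasing_above \<pi> i v C" "card C = k - l"
    using assms(4) unfolding covered_def by blast
  have "finite C"
    using C(1) finite_subset unfolding increasing_above_def by blast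
  define h where "h t = sorted_list_of_set C ! t" for t
  have h_mono: "h s < h t" if "s < t" "t < k - l" for s t
    using sorted_wrt_nth_less[OF strict_sorted_list_of_set[of C] that(1)] that C(2)
    unfolding h_def by simp
  have h_in: "h t \<in> C" if "t < k - l" for t
    using nth_mem[of t "sorted_list_of_set C"] that C(2) \<open>finite C\<close> unfolding h_def by simp
  have h: "i < h (a - l)" "h (a - l) < length \<pi>" "v < \<pi> ! h (a - l)" if "l \<le> a" "a < k" for a
    using h_in[of "a - l"] C(1) that unfolding increasing_above_def by fastforce+
  have \<pi>_mono: "\<pi> ! h (a - l) < \<pi> ! h (b - l)" if "l \<le> a" "a < b" "b < k" for a b
    using C(1) h_in[of "a - l"] h_in[of "b - l"] h_mono[of "a - l" "b - l"] that
    unfolding increasing_above_def strict_mono_on_def by (auto simp: diff_less_mono)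
  define f where "f a = (if a < l then g a else h (a - l))" for a
  have "strict_mono_on {..<k} f"
  proof (rule strict_mono_onI)
    fix a b assume ab: "a \<in> {..<k}" "b \<in> {..<k}" "a < b"
    consider "b < l" | "a < l" "l \<le> b" | "l \<le> a"
      by linarith
    then show "f a < f b"
    proof cases
      case 1
      then show ?thesis
        using g ab len unfolding f_def occurrence_def strict_mono_on_def by auto
    next
      case 2
      then show ?thesis
        using corner[of a] h(1)[of b] ab
        unfolding f_def by auto
    next
      case 3
      then show ?thesis
        using h_mono[of "a - l" "b - l"] ab unfolding f_def by auto
    qed
  qed
  moreover have "f ` {..<k} \<subseteq> {..<length \<pi>}"
    using g h(2) len unfolding f_def occurrence_def by auto
  moreover have "\<bar>\<pi> ! f a\<bar> < \<bar>\<pi> ! f b\<bar> \<longleftrightarrow> \<bar>P ! a\<bar> < \<bar>P ! b\<bar>" if ab: "a < k" "b < k" for a b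
  proof -
    \<comment> \<open>In the mixed cases \<open>v\<close> separates the absolute values in
      \<open>\<pi>\<close>, just as \<open>l\<close> separates those in \<open>P\<close>.\<close>
    consider "a < l" "b < l" | "a < l" "l \<le> b" | "l \<le> a" "b < l" | "l \<le> a" "l \<le> b"
      by linarith
    then show ?thesis
    proof cases
      case 1
      then show ?thesis
        using g len P_nth ab unfolding f_def occurrence_def by auto
    next
      case 2
      then show ?thesis
        using corner[of a] h(3)[of b] \<tau>_le[of a] P_nth ab unfolding f_def by auto
    next
      case 3
      then show ?thesis
        using corner[of b] h(3)[of a] \<tau>_le[of b] P_nth ab unfolding f_def by auto
    next
      case 4
      then show ?thesis
        using \<pi>_mono[of a b] \<pi>_mono[of b a] h(3)[of a]
          h(3)[of b] P_nth ab \<open>0 \<le> v\<close> unfolding f_def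
        by (cases a b rule: linorder_cases) auto
    qed
  qed
  moreover have "\<pi> ! f a > 0 \<longleftrightarrow> P ! a > 0" if "a < k" for a
  proof (cases "a < l")
    case True
    then show ?thesis
      using g len P_nth that unfolding f_def occurrence_def by auto
  next
    case False
    then show ?thesis
      using h(3)[of a] P_nth that \<open>0 \<le> v\<close> unfolding f_def by auto
  qed
  ultimately have "occurrence \<pi> P f"
    unfolding occurrence_def len by blast
  then show ?thesis
    unfolding P_def sp_contains_iff_occurrence by blast
qed

section \<open>Transport of pattern copies by the sign change\<close>

text \<open>All letters of the copy of \<open>\<tau>\<close> lie south-west of a covered corner, so
  each is negated and the same positions carry a copy of \<open>bar \<tau>\<close>. The corner stays
  covered, hence this copy can be prolonged again.\<close>

lemma contains_flip_covered:
  assumes "\<tau> \<in> signed_perms l" "0 < l" "l \<le> k" "\<pi> \<in> signed_perms n"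
    and "sp_contains \<pi> (\<tau> @ [int l + 1..int k])"
  shows "sp_contains (flip_covered (k - l) \<pi>) (bar \<tau> @ [int l + 1..int k])"
proof -
  define \<pi>' where "\<pi>' = flip_covered (k - l) \<pi>"
  have len: "length \<tau> = l" "length (bar \<tau>) = l" "length \<pi> = n" "length \<pi>' = n"
    using assms by (auto simp: signed_perms_def bar_def \<pi>'_def)
  obtain g i v where g: "occurrence \<pi> \<tau> g" and cov: "covered (k - l) \<pi> i v"
    and corner: "\<And>a. a < l \<Longrightarrow> g a \<le> i \<and> \<bar>\<pi> ! g a\<bar> \<le> v"
    using contains_append_upto_imp_covered[OF assms(1-3,5)] by blast
  have g_less: "g a < n" if "a < l" for a
    using g that len unfolding occurrence_def by auto
  have flipped: "\<pi>' ! g a = - (\<pi> ! g a)" if "a < l" for a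
    using covered_antimono[OF cov] corner[OF that] g_less[OF that] len
    unfolding \<pi>'_def by (simp add: nth_flip_covered)
  \<comment> \<open>Negation exchanges positive and non-positive letters only away from
    zero.\<close>
  have nonzero: "\<pi> ! g a \<noteq> 0" "\<tau> ! a \<noteq> 0" if "a < l" for a
    using signed_perms_abs_nth[OF assms(4) g_less[OF that]]
      signed_perms_abs_nth[OF assms(1) that] by auto
  have sign: "\<pi> ! g a > 0 \<longleftrightarrow> \<tau> ! a > 0" if "a < l" for a
    using g that len unfolding occurrence_def by auto
  have "\<pi>' ! g a > 0 \<longleftrightarrow> bar \<tau> ! a > 0" if "a < l" for a
    using sign[OF that] nonzero[OF that] that len flipped[OF that] unfolding bar_def by auto
  then have occ: "occurrence \<pi>' (bar \<tau>) g"
    using g flipped len unfolding occurrence_def by (auto simp: bar_def)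
  show ?thesis
    unfolding \<pi>'_def[symmetric]
  proof (rule covered_imp_contains_append_upto[OF bar_signed_perms[OF assms(1)] assms(3) occ])
    show "covered (k - l) \<pi>' i v"
      using cov unfolding \<pi>'_def by simp
    show "g a \<le> i \<and> \<bar>\<pi>' ! g a\<bar> \<le> v" if "a < l" for a
      using corner[OF that] flipped[OF that] by simp
    show "0 \<le> v"
      using corner[OF assms(2)] by linarith
  qed
qed

text \<open>Both \<open>bar\<close> and the sign change are involutions, so the converse is the
  forward direction for \<open>bar \<tau>\<close> and the changed word.\<close>

lemma contains_flip_covered_iff:
  assumes "\<tau> \<in> signed_perms l" "0 < l" "l \<le> k" "\<pi> \<in> signed_perms n"
  shows "sp_contains (flip_covered (k - l) \<pi>) (bar \<tau> @ [int l + 1..int k]) \<longleftrightarrow>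
         sp_contains \<pi> (\<tau> @ [int l + 1..int k])"
proof -
  have "bar (bar \<tau>) = \<tau>"
    by (simp add: bar_def comp_def)
  then show ?thesis
    using contains_flip_covered[OF assms]
      contains_flip_covered[OF bar_signed_perms[OF assms(1)] assms(2,3)
        flip_covered_signed_perms[OF assms(4), of "k - l"]]
    by auto
qed

text \<open>A general invariant \<open>M\<close> covers signed permutations and signed involutions
  at once. The case \<open>l = 0\<close> is separate because an empty \<open>\<tau>\<close> has no
  bounding corner; there both patterns coincide.\<close>

lemma card_avoiders_eq:
  assumes "\<tau> \<in> signed_perms l" "l \<le> k" "M \<subseteq> signed_perms n"
    and "\<And>\<pi>. \<pi> \<in> M \<Longrightarrow> flip_covered (k - l) \<pi> \<in> M"
  shows "card (avoiders M (\<tau> @ [int l + 1..int k])) =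
         card (avoiders M (bar \<tau> @ [int l + 1..int k]))"
proof (cases "l = 0")
  case True
  then have "bar \<tau> = \<tau>"
    using assms(1) by (simp add: signed_perms_def bar_def)
  then show ?thesis
    by simp
next
  case False
  let ?\<phi> = "flip_covered (k - l)"
  let ?P = "\<tau> @ [int l + 1..int k]" and ?Q = "bar \<tau> @ [int l + 1..int k]"
  have iff: "sp_contains (?\<phi> \<pi>) ?Q \<longleftrightarrow> sp_contains \<pi> ?P" if "\<pi> \<in> M" for \<pi>
    using contains_flip_covered_iff[of \<tau> l k \<pi> n] assms that False by blast
  have "bij_betw ?\<phi> (avoiders M ?P) (avoiders M ?Q)"
  proof (rule bij_betw_byWitness[where f' = ?\<phi>])
    show "?\<phi> ` avoiders M ?P \<subseteq> avoiders M ?Q"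
      using iff assms(4) unfolding avoiders_def by auto
    show "?\<phi> ` avoiders M ?Q \<subseteq> avoiders M ?P"
      using iff[OF assms(4)] assms(4) unfolding avoiders_def by auto
  qed simp_all
  then show ?thesis
    by (rule bij_betw_same_card)
qed

subsection \<open>Signed involutions\<close>

text \<open>By oddness it suffices to test the arguments \<open>1, ..., n\<close>. Positions count
  from 0 and values from 1, whence the shifts by one.\<close>

lemma signed_involutions_iff:
  "\<pi> \<in> signed_involutions n \<longleftrightarrow>
     \<pi> \<in> signed_perms n \<and> (\<forall>j<n. \<pi> ! (nat \<bar>\<pi> ! j\<bar> - 1) = sgn (\<pi> ! j) * (int j + 1))"
proof (cases "\<pi> \<in> signed_perms n")
  case True
  have odd: "sp_fun \<pi> (- i) = - sp_fun \<pi> i" if "i \<noteq> 0" for i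
    using that by (auto simp: sp_fun_def)
  have nonzero: "\<pi> ! j \<noteq> 0" if "j < n" for j
    using signed_perms_abs_nth[OF True that] by auto
  have step: "sp_fun \<pi> (sp_fun \<pi> (int j + 1)) = int j + 1 \<longleftrightarrow>
      \<pi> ! (nat \<bar>\<pi> ! j\<bar> - 1) = sgn (\<pi> ! j) * (int j + 1)" if "j < n" for j
  proof -
    have "sp_fun \<pi> (int j + 1) = \<pi> ! j"
      by (simp add: sp_fun_def nat_add_distrib)
    then show ?thesis
      using nonzero[OF that] by (cases "\<pi> ! j > 0") (auto simp: sp_fun_def)
  qed
  have "(\<forall>i \<in> {- int n..int n} - {0}. sp_fun \<pi> (sp_fun \<pi> i) = i) \<longleftrightarrow>
        (\<forall>j<n. sp_fun \<pi> (sp_fun \<pi> (int j + 1)) = int j + 1)"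
  proof (intro iffI ballI)
    fix i assume H: "\<forall>j<n. sp_fun \<pi> (sp_fun \<pi> (int j + 1)) = int j + 1"
      and i: "i \<in> {- int n..int n} - {0}"
    define j where "j = nat \<bar>i\<bar> - 1"
    have j: "j < n" "i = int j + 1 \<or> i = - (int j + 1)"
      using i unfolding j_def by auto
    have "sp_fun \<pi> (int j + 1) = \<pi> ! j"
      by (simp add: sp_fun_def nat_add_distrib)
    \<comment> \<open>Oddness of \<open>sp_fun\<close> fails at 0, so both the argument and its
      image must be nonzero.\<close>
    then have "sp_fun \<pi> (int j + 1) \<noteq> 0"
      using nonzero[OF j(1)] by simp
    then show "sp_fun \<pi> (sp_fun \<pi> i) = i"
      using j H odd[of "int j + 1"] odd[of "sp_fun \<pi> (int j + 1)"] by auto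
  qed auto
  then show ?thesis
    using True step unfolding signed_involutions_def by simp
qed (simp add: signed_involutions_def)

text \<open>In a signed involution a positive letter and its reflection in the diagonal both occur,
  and reflection preserves increasing sequences. With positions counted from 1 the two cells are
  \<open>(i + 1, j + 1)\<close> and \<open>(j + 1, i + 1)\<close>.\<close>

lemma covered_transpose:
  assumes "\<pi> \<in> signed_involutions n" "covered m \<pi> i (int j + 1)"
  shows "covered m \<pi> j (int i + 1)"
proof -
  \<comment> \<open>The position, counted from 0, of the reflected letter; \<open>\<pi> ! p\<close>
    is positive on the witness, so no absolute value is taken.\<close>
  define q where "q p = nat (\<pi> ! p) - 1" for p
  have perm: "\<pi> \<in> signed_perms n"
    and inv: "\<And>p. p < n \<Longrightarrow> \<pi> ! (nat \<bar>\<pi> ! p\<bar> - 1) = sgn (\<pi> ! p) * (int p + 1)"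
    using assms(1) by (auto simp: signed_involutions_iff)
  have len: "length \<pi> = n"
    using perm by (simp add: signed_perms_def)
  obtain C where C: "increasing_above \<pi> i (int j + 1) C" "card C = m"
    using assms(2) unfolding covered_def by blast
  have C_bounds: "i < p" "p < n" "int j + 1 < \<pi> ! p" if "p \<in> C" for p
    using C(1) that len unfolding increasing_above_def by auto
  have \<pi>_q: "\<pi> ! q p = int p + 1" if "p \<in> C" for p
    using inv[of p] C_bounds[OF that] unfolding q_def by simp
  have q_bounds: "j < q p" "q p < n" if "p \<in> C" for p
    using C_bounds[OF that] signed_perms_abs_nth[OF perm, of p] unfolding q_def by auto
  have q_mono: "q x < q y" if "x \<in> C" "y \<in> C" "x < y" for x y
  proof -
    have "\<pi> ! x < \<pi> ! y"
      using C(1) that unfolding increasing_above_def strict_mono_on_def by blast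
    then show ?thesis
      using C_bounds[OF that(1)] unfolding q_def by linarith
  qed
  have "increasing_above \<pi> j (int i + 1) (q ` C)"
    unfolding increasing_above_def
  proof (intro conjI)
    show "q ` C \<subseteq> {j<..<length \<pi>}"
      using q_bounds len by auto
    show "\<forall>p\<in>q ` C. int i + 1 < \<pi> ! p"
      using \<pi>_q C_bounds(1) by force
    show "strict_mono_on (q ` C) ((!) \<pi>)"
    proof (rule strict_mono_onI)
      fix a b assume "a \<in> q ` C" "b \<in> q ` C" "a < b"
      then obtain x y where xy: "a = q x" "b = q y" "x \<in> C" "y \<in> C" "q x < q y"
        by auto
      have "x < y"
        using q_mono[of y x] xy by (cases x y rule: linorder_cases) auto
      then show "\<pi> ! a < \<pi> ! b"
        using xy \<pi>_q by simp
    qed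
  qed
  moreover have "inj_on q C"
    by (rule inj_onI) (metis q_mono less_irrefl linorder_neqE_nat)
  then have "card (q ` C) = m"
    using C(2) by (simp add: card_image)
  ultimately show ?thesis
    unfolding covered_def by blast
qed

text \<open>The letters at \<open>j\<close> and at its partner position occupy cells that are mirror
  images. By symmetry of the covered region both signs change or neither does, so the relation
  between the two letters persists.\<close>

lemma flip_covered_signed_involutions:
  assumes "\<pi> \<in> signed_involutions n"
  shows "flip_covered m \<pi> \<in> signed_involutions n"
proof -
  let ?\<pi>' = "flip_covered m \<pi>"
  have perm: "\<pi> \<in> signed_perms n"
    and inv: "\<And>j. j < n \<Longrightarrow> \<pi> ! (nat \<bar>\<pi> ! j\<bar> - 1) = sgn (\<pi> ! j) * (int j + 1)"
    using assms by (auto simp: signed_involutions_iff)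
  have len: "length \<pi> = n"
    using perm by (simp add: signed_perms_def)
  have "?\<pi>' ! (nat \<bar>?\<pi>' ! j\<bar> - 1) = sgn (?\<pi>' ! j) * (int j + 1)" if "j < n" for j
  proof -
    define q where "q = nat \<bar>\<pi> ! j\<bar> - 1"
    have "\<bar>\<pi> ! j\<bar> \<in> {1..int n}"
      using signed_perms_abs_nth[OF perm that] .
    then have q: "q < n" "\<bar>\<pi> ! j\<bar> = int q + 1" and "\<pi> ! j \<noteq> 0"
      unfolding q_def by auto
    have \<pi>_q: "\<pi> ! q = sgn (\<pi> ! j) * (int j + 1)"
      using inv[OF that] unfolding q_def .
    then have "\<bar>\<pi> ! q\<bar> = int j + 1"
      using \<open>\<pi> ! j \<noteq> 0\<close> by (simp add: abs_mult)
    \<comment> \<open>One implication of \<open>covered_transpose\<close>, used with the two cells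
      in either order, gives the equivalence.\<close>
    then have "covered m \<pi> q \<bar>\<pi> ! q\<bar> \<longleftrightarrow> covered m \<pi> j \<bar>\<pi> ! j\<bar>"
      using covered_transpose[OF assms] q(2) by metis
    then have "?\<pi>' ! q = sgn (?\<pi>' ! j) * (int j + 1)"
      using \<pi>_q q(1) that len by (simp add: nth_flip_covered sgn_minus)
    then show ?thesis
      using that len unfolding q_def by simp
  qed
  then show ?thesis
    using flip_covered_signed_perms[OF perm] by (simp add: signed_involutions_iff)
qed

theorem theorem2p1:
  fixes l k :: nat and \<tau> P Q :: "int list"
  assumes "l \<le> k"
    and "\<tau> \<in> signed_perms l"
    and "P = \<tau> @ [int l + 1..int k]"
    and "Q = bar \<tau> @ [int l + 1..int k]"
  shows "wilf_equivalent P Q \<and>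
    (\<forall>n\<ge>1. card (avoiders (signed_involutions n) P) = card (avoiders (signed_involutions n) Q))"
proof -
  have "card (avoiders (signed_perms n) P) = card (avoiders (signed_perms n) Q)" for n
    unfolding assms(3,4)
    by (rule card_avoiders_eq[OF assms(2,1) subset_refl flip_covered_signed_perms])
  moreover have "signed_involutions n \<subseteq> signed_perms n" for n
    unfolding signed_involutions_def by blast
  then have "card (avoiders (signed_involutions n) P) = card (avoiders (signed_involutions n) Q)" for n
    unfolding assms(3,4)
    by (rule card_avoiders_eq[OF assms(2,1) _ flip_covered_signed_involutions])
  ultimately show ?thesis
    unfolding wilf_equivalent_def by blast
qed

end
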